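(* Let $a,b,p,u,v$ be integers, restricted in the case of each continued fraction below so that the partial quotients are all positive. Then $$[0;\overline{p-1,1,u(a+2nb)-1,p-1,1,v(a+(2n+1)b)-1}]_{n=0}^{\infty}=\frac1p+\frac1p\sqrt{\frac vu}\,\frac{I_{a/b}\!\left(\frac{2}{bp\sqrt{uv}}\right)}{I_{a/b-1}\!\left(\frac{2}{bp\sqrt{uv}}\right)},$$ $$[0;p-1,\overline{1,(4n+1)u-1,p,(4n+3)v-1,1,p-2}]_{n=0}^{\infty}=\frac1p+\frac1p\sqrt{\frac vu}\,\tan\frac{1}{p\sqrt{uv}},$$ $$[0;\overline{p-1,1,(4n+1)u-1,p-1,1,(4n+3)v-1}]_{n=0}^{\infty}=\frac1p+\frac1p\sqrt{\frac vu}\,\tanh\frac{1}{p\sqrt{uv}},$$ $$[0;p-1,\overline{1,(4n+1)u-1,p-1,1,2v-1,p,(4n+3)u-1,1,p-1,2v-1,1,p-2}]_{n=0}^{\infty}=\frac1p+v\left(1-e^{-1/(up^2v)}\right).$$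
   Context: $[x_0;x_1,x_2,\dots]$ denotes the value (limit of convergents) of the continued fraction $x_0+\cfrac{1}{x_1+\cfrac{1}{x_2+\cdots}}$; the partial quotients referred to are those after the initial $0$. An overlined block $\overline{f_1(n),\dots,f_k(n)}$ with subscript $n=0$ and superscript $\infty$ means that the blocks $f_1(n),\dots,f_k(n)$ are concatenated for $n=0,1,2,\dots$. The function $I_\nu$ is given by $I_\nu(z)=\sum_{m=0}^\infty\frac{(z/2)^{\nu+2m}}{\Gamma(m+1)\Gamma(\nu+m+1)}$.
   Formalization: In the first identity b > 0 is added: b = 0 leaves a/b undefined, and for b < 0 positivity makes the Bessel argument negative and the identity false, e.g. (a,b,p,u,v) = (-2,-1,2,-1,-1) gives about 0.62 on the left and 0.38 on the right. *)

theory Defs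
  imports "HOL-Analysis.Analysis" "HOL-Library.Stream"
begin

text \<open>
  An infinite continued fraction \<open>[x\<^sub>0; x\<^sub>1, x\<^sub>2, \<dots>]\<close> is given by the stream of its entries,
  the integer part \<open>x\<^sub>0\<close> being the head.
\<close>

primrec cf_convergent :: "int stream \<Rightarrow> nat \<Rightarrow> real" where
  "cf_convergent x 0 = of_int (shd x)"
| "cf_convergent x (Suc n) = of_int (shd x) + 1 / cf_convergent (stl x) n"

text \<open>Convergence is part of the claim, hence a relation instead of a limit operator.\<close>

definition cf_has_value :: "int stream \<Rightarrow> real \<Rightarrow> bool" where
  "cf_has_value x L \<longleftrightarrow> cf_convergent x \<longlonglongrightarrow> L"

definition cf_positive :: "int stream \<Rightarrow> bool" where
  "cf_positive x \<longleftrightarrow> (\<forall>k\<ge>1. x !! k > 0)"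

text \<open>
  The overlined block: \<open>f 0 @ f 1 @ f 2 @ \<dots>\<close>. The library function \<open>flat\<close> requires every
  \<open>f n\<close> to be nonempty.
\<close>

definition overlined :: "(nat \<Rightarrow> int list) \<Rightarrow> int stream" where
  "overlined f = flat (smap f nats)"

text \<open>
  Modified Bessel function of the first kind, for real order and argument \<open>z > 0\<close>. At the poles
  of the Gamma function the library has \<open>Gamma x = 0\<close> and \<open>1 / 0 = 0\<close>, which agrees with the
  convention that the reciprocal Gamma function vanishes there.
\<close>

definition bessel_I :: "real \<Rightarrow> real \<Rightarrow> real" where
  "bessel_I \<nu> z =
     (\<Sum>m. (z / 2) powr (\<nu> + 2 * real m) / (Gamma (real m + 1) * Gamma (\<nu> + real m + 1)))"

end

theory Submission
  imports Defs
begin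

text \<open>
  A positive continued fraction converges to \<open>y\<close> as soon as \<open>y\<close> can be expanded along it with
  positive remainders. In the first expansion the tails starting at \<open>p - 1\<close> have the form
  \<open>p / (1 + w)\<close>, and the block \<open>p - 1, 1, A - 1\<close> turns into \<open>1 / w = p A + w'\<close>; the other
  blocks are similar, up to signs. This recursion is solved by the quotient \<open>R \<nu> t\<close> of contiguous
  confluent hypergeometric limit functions, which satisfies \<open>R \<nu> t = \<nu> + t / R (\<nu> + 1) t\<close>.
  For \<open>t > 0\<close> it is a quotient of modified Bessel functions, and for \<open>\<nu> = 1/2\<close> it is elementary.
\<close>

section \<open>Convergence of continued fractions\<close>

text \<open>The form \<open>p / (1 + w)\<close> comes from
  \<open>q - 1 / r = [q - 1; 1, r - 1]\<close>: the entries \<open>p - 1, 1, A - 1\<close> before a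
  tail \<open>y'\<close> encode \<open>y = p - 1 / (A + 1 / y')\<close>, and the substitution
  \<open>w = p / y - 1\<close> conjugates this to \<open>w = 1 / (p * A + w')\<close>. A sparser
  fraction with partial denominators \<open>p * A\<close> is thus hidden in the given one. The
  entries \<open>p, B - 1, 1\<close> encode the same map with \<open>A = - B\<close>; so the partial
  denominators have signs \<open>+, -\<close> in the tangent case and \<open>+, +, -, -\<close> in
  the exponential case. The obstacle is positivity of the remainders. For \<open>t > 0\<close> the
  hypergeometric series has positive terms, but for \<open>t < 0\<close> positivity rests on
  explicit bounds. Tails with negative \<open>w\<close> moreover need \<open>w > - 1\<close>, and a
  block that starts one entry late needs \<open>w < 1 / (p - 1)\<close>. In the exponential case the
  entries from \<open>2 * v\<close> do not grow. There one step of a hyperbolic cotangent recursion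
  \<open>k = c * p * A + 1 / k'\<close> with \<open>c = 2 * p * v\<close> is spread over two steps,
  \<open>w = c / (1 + k)\<close> and \<open>w1 = (1 + 1 / k') / c\<close>.\<close>

coinductive expands :: "int stream \<Rightarrow> real \<Rightarrow> bool" where
  "a \<ge> 1 \<Longrightarrow> y > 0 \<Longrightarrow> expands s y \<Longrightarrow> expands (a ## s) (of_int a + 1 / y)"

text \<open>Applied to the remainders themselves, this upgrades positive to at least 1, which is
  what makes the error contract.\<close>

lemma expands_ge_1: "y \<ge> 1" if "expands s y"
  using that by cases (auto intro!: add_increasing2)

lemma cf_convergent_ge_1: "cf_convergent s n \<ge> 1" if "expands s y"
  using that
proof (induction n arbitrary: s y)
  case 0
  then show ?case by cases auto
next
  case (Suc n)
  from Suc.prems show ?case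
  proof cases
    case (1 a y' s')
    then have "cf_convergent s' n \<ge> 1" using Suc.IH by blast
    then show ?thesis using 1 by (simp add: add_increasing2)
  qed
qed

lemma abs_inverse_diff:
  fixes s t :: real
  assumes "s > 0" "t > 0"
  shows "\<bar>1 / s - 1 / t\<bar> = \<bar>s - t\<bar> / (s * t)"
proof -
  have "1 / s - 1 / t = (t - s) / (s * t)" using assms by (simp add: field_simps)
  then show ?thesis using assms by (simp add: abs_minus_commute abs_mult)
qed

text \<open>A single step need not contract, but two do: they divide the error by
  \<open>(t * t') * (c * c')\<close>, and \<open>t * t' = a' * t' + 1\<close> is at least 2,
  likewise \<open>c * c'\<close>. The constant 2 is dictated by \<open>n = 1\<close>, where the
  error is bounded by 1.\<close>

lemma expands_error: "\<bar>y - cf_convergent s n\<bar> \<le> 2 * (1 / 2) ^ n" if "expands s y"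
  using that
proof (induction n arbitrary: s y rule: less_induct)
  case (less n)
  from less.prems obtain a t s' where s: "s = a ## s'" and y: "y = of_int a + 1 / t"
    and t: "expands s' t" by cases auto
  from t obtain a' t' s'' where s': "s' = a' ## s''" and t_eq: "t = of_int a' + 1 / t'"
    and a': "a' \<ge> 1" and t': "expands s'' t'" by cases auto
  have t1: "t \<ge> 1" and t'1: "t' \<ge> 1" using t t' expands_ge_1 by auto
  consider "n = 0" | "n = 1" | m where "n = Suc (Suc m)"
    by (metis One_nat_def not0_implies_Suc)
  then show ?case
  proof cases
    case 1
    have "1 / t \<le> 1" using t1 by simp
    moreover have "1 / t \<ge> 0" using t1 by simp
    ultimately have "\<bar>1 / t\<bar> \<le> 2" by linarith
    then show ?thesis using 1 s y by simp
  next
    case 2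
    have "1 / t \<le> 1" "1 / real_of_int a' \<le> 1" "1 / t \<ge> 0" "1 / real_of_int a' \<ge> 0"
      using t1 a' by auto
    then have "\<bar>1 / t - 1 / real_of_int a'\<bar> \<le> 1" by linarith
    then show ?thesis using 2 s s' y by simp
  next
    case 3
    define c' where "c' = cf_convergent s'' m"
    define c where "c = cf_convergent s' (Suc m)"
    have c: "c = of_int a' + 1 / c'" unfolding c_def c'_def s' by simp
    have c1: "c \<ge> 1" and c'1: "c' \<ge> 1"
      unfolding c_def c'_def using cf_convergent_ge_1 t t' by blast+
    have "\<bar>y - cf_convergent s n\<bar> = \<bar>1 / t - 1 / c\<bar>"
      using 3 s y by (simp add: c_def)
    also have "\<dots> = \<bar>t - c\<bar> / (t * c)" using t1 c1 by (intro abs_inverse_diff) auto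
    also have "\<bar>t - c\<bar> = \<bar>1 / t' - 1 / c'\<bar>" by (simp add: t_eq c)
    also have "\<dots> = \<bar>t' - c'\<bar> / (t' * c')" using t'1 c'1 by (intro abs_inverse_diff) auto
    also have "\<dots> / (t * c) = \<bar>t' - c'\<bar> / ((t * t') * (c * c'))" by simp
    also have "\<dots> \<le> \<bar>t' - c'\<bar> / (2 * 2)"
    proof (rule divide_left_mono)
      have ge_2: "2 \<le> (of_int a' + 1 / r) * r" if "r \<ge> 1" for r :: real
      proof -
        have "1 * 1 \<le> of_int a' * r" using that a' by (intro mult_mono) auto
        then show ?thesis using that by (simp add: field_simps)
      qed
      have "2 \<le> t * t'" "2 \<le> c * c'" unfolding t_eq c using t'1 c'1 by (auto intro: ge_2)
      then show "2 * 2 \<le> (t * t') * (c * c')" by (intro mult_mono) auto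
    qed (use t1 t'1 c1 c'1 in auto)
    also have "\<dots> \<le> 2 * (1 / 2) ^ m / 4"
      using less.IH[of m s'' t'] 3 t' by (simp add: c'_def)
    also have "\<dots> = 2 * (1 / 2) ^ n" using 3 by simp
    finally show ?thesis .
  qed
qed

lemma expands_has_value: "cf_has_value s y" if "expands s y"
proof -
  have lim: "(\<lambda>n. 2 * (1 / 2) ^ n :: real) \<longlonglongrightarrow> 0"
    by (intro tendsto_mult_right_zero LIMSEQ_power_zero) auto
  have "norm (cf_convergent s n - y) \<le> 2 * (1 / 2) ^ n" for n
    using expands_error[OF that, of n] by (subst norm_minus_commute) (simp only: real_norm_def)
  then have "(\<lambda>n. cf_convergent s n - y) \<longlonglongrightarrow> 0"
    by (intro Lim_null_comparison[OF _ lim] always_eventually) blast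
  then show ?thesis unfolding cf_has_value_def by (simp add: LIM_zero_iff)
qed

text \<open>Allows the integer part 0 in front, which \<open>expands\<close> excludes.\<close>

lemma cf_has_value_SCons:
  assumes "cf_has_value s y" "y \<noteq> 0"
  shows "cf_has_value (a ## s) (of_int a + 1 / y)"
proof -
  have "(\<lambda>n. of_int a + 1 / cf_convergent s n) \<longlonglongrightarrow> of_int a + 1 / y"
    using assms unfolding cf_has_value_def by (intro tendsto_intros)
  then have "(\<lambda>n. cf_convergent (a ## s) (Suc n)) \<longlonglongrightarrow> of_int a + 1 / y"
    by simp
  then show ?thesis unfolding cf_has_value_def by (rule LIMSEQ_imp_Suc)
qed

abbreviation cf_append :: "int list \<Rightarrow> real \<Rightarrow> real" where
  "cf_append xs y \<equiv> foldr (\<lambda>x t. of_int x + 1 / t) xs y"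

lemma cf_append_pos: "\<forall>x\<in>set xs. x \<ge> 1 \<Longrightarrow> y > 0 \<Longrightarrow> cf_append xs y > 0"
  by (induction xs) (auto intro!: add_pos_pos)

text \<open>Bridges two scales: remainders are known only at the block boundaries, whereas
  \<open>expands\<close> demands one at every entry.\<close>

lemma expands_overlined:
  assumes nonempty: "\<And>n. f n \<noteq> []"
    and entries: "\<And>n. \<forall>x\<in>set (f n). x \<ge> 1"
    and y_pos: "\<And>n. y n > 0"
    and y_step: "\<And>n. y n = cf_append (f n) (y (Suc n))"
  shows "expands (overlined f) (y 0)"
proof -
  define T where "T n = flat (smap f (fromN n))" for n
  have T: "T n = f n @- T (Suc n)" for n
  proof -
    have "smap f (fromN n) = f n ## smap f (fromN (Suc n))"
      by (subst siterate.code) simp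
    then show ?thesis unfolding T_def using nonempty flat_Stream by metis
  qed
  \<comment> \<open>In the invariant, \<open>xs\<close> is the unread rest of the current block.
    Once it is empty, \<open>y_step\<close> opens the next block.\<close>
  have "expands s r" if "\<exists>n xs. s = xs @- T n \<and> r = cf_append xs (y n) \<and> (\<forall>x\<in>set xs. x \<ge> 1)" for s r
    using that
  proof (coinduction arbitrary: s r)
    case (expands s r)
    then obtain n xs where *: "s = xs @- T n" "r = cf_append xs (y n)" "\<forall>x\<in>set xs. x \<ge> 1"
      by blast
    have "\<exists>m z zs. s = (z # zs) @- T m \<and> r = cf_append (z # zs) (y m) \<and> (\<forall>x\<in>set (z # zs). x \<ge> 1)"
    proof (cases xs)
      case Nil
      obtain z zs where "f n = z # zs" using nonempty[of n] by (cases "f n") auto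
      then show ?thesis using Nil * T[of n] y_step[of n] entries[of n]
        by (intro exI[of _ "Suc n"] exI[of _ z] exI[of _ zs]) auto
    next
      case (Cons z zs)
      then show ?thesis using * by (intro exI[of _ n] exI[of _ z] exI[of _ zs]) auto
    qed
    then obtain m z zs where "s = (z # zs) @- T m" "r = cf_append (z # zs) (y m)"
      "\<forall>x\<in>set (z # zs). x \<ge> 1" by blast
    moreover from this have "cf_append zs (y m) > 0" by (intro cf_append_pos y_pos) auto
    ultimately show ?case
      by (intro exI[of _ z] exI[of _ "cf_append zs (y m)"] exI[of _ "zs @- T m"]) auto
  qed
  from this[of "T 0" "y 0"] show ?thesis
    unfolding T_def overlined_def by (metis empty_iff foldr_Nil id_apply list.set(1) shift.simps(1))
qed

lemma cf_positive_SCons: "cf_positive (a ## s) \<longleftrightarrow> (\<forall>x\<in>sset s. x > 0)"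
proof -
  have "cf_positive (a ## s) \<longleftrightarrow> (\<forall>k. s !! k > 0)"
    unfolding cf_positive_def
    by (metis One_nat_def Suc_le_D Suc_le_mono le0 snth.simps(2) stream.sel(2))
  then show ?thesis by (auto simp: sset_range)
qed

lemma sset_overlined: "sset (overlined f) = (\<Union>n. set (f n))" if "\<And>n. f n \<noteq> []"
  unfolding overlined_def using that by (subst sset_flat) (auto simp: stream.set_map)

section \<open>The confluent hypergeometric limit function\<close>

definition hyp01 :: "real \<Rightarrow> real \<Rightarrow> real" where
  "hyp01 c t = (\<Sum>m. t ^ m / (fact m * pochhammer c m))"

lemma summable_hyp01:
  assumes "c > 0"
  shows "summable (\<lambda>m. t ^ m / (fact m * pochhammer c m) :: real)"
proof (rule summable_ratio_test[of "1 / 2" "nat \<lceil>2 * \<bar>t\<bar> / c\<rceil>"])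
  fix n assume n: "n \<ge> nat \<lceil>2 * \<bar>t\<bar> / c\<rceil>"
  have "2 * \<bar>t\<bar> / c \<le> real n" using n by linarith
  then have "2 * \<bar>t\<bar> \<le> real n * c" using assms by (simp add: field_simps)
  also have "\<dots> \<le> (real n + 1) * (c + real n)" using assms by (intro mult_mono) auto
  finally have le: "\<bar>t\<bar> / ((real n + 1) * (c + real n)) \<le> 1 / 2"
    using assms by (simp add: divide_le_eq)
  have "norm (t ^ Suc n / (fact (Suc n) * pochhammer c (Suc n)))
      = \<bar>t\<bar> / ((real n + 1) * (c + real n)) * norm (t ^ n / (fact n * pochhammer c n))"
    using assms pochhammer_pos[OF assms, of n]
    by (simp add: pochhammer_Suc abs_mult power_abs mult_ac add_ac)
  also have "\<dots> \<le> 1 / 2 * norm (t ^ n / (fact n * pochhammer c n))"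
    by (intro mult_right_mono le) auto
  finally show "norm (t ^ Suc n / (fact (Suc n) * pochhammer c (Suc n)))
      \<le> 1 / 2 * norm (t ^ n / (fact n * pochhammer c n))" .
qed auto

lemma hyp01_pos:
  assumes "c > 0" "t > 0"
  shows "hyp01 c t > 0"
  unfolding hyp01_def using assms pochhammer_pos[of c]
  by (intro suminf_pos summable_hyp01) auto

text \<open>Holds coefficientwise after an index shift: over the common denominator
  \<open>c * (c + 1) * pochhammer (c + 2) m\<close> the numerators at index \<open>Suc m\<close> are
  \<open>c + 1 + m\<close> and \<open>c\<close>, and their difference \<open>m + 1\<close> cancels
  against \<open>fact (Suc m)\<close>.\<close>

lemma hyp01_contiguous:
  assumes c: "c > 0"
  shows "hyp01 c t = hyp01 (c + 1) t + t / (c * (c + 1)) * hyp01 (c + 2) t"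
proof -
  define f where "f c m = t ^ m / (fact m * pochhammer c m)" for c :: real and m
  have sums: "f r sums hyp01 r t" if "r > 0" for r
    unfolding f_def hyp01_def using summable_hyp01[OF that] by (rule summable_sums)
  have term_eq: "f c (Suc m) - f (c + 1) (Suc m) = t / (c * (c + 1)) * f (c + 2) m" for m
  proof -
    define q where "q = pochhammer (c + 2) m"
    have q: "q > 0" unfolding q_def using c by (intro pochhammer_pos) auto
    have 1: "pochhammer c (Suc m) = c * pochhammer (c + 1) m"
      by (simp add: pochhammer_rec)
    have 2: "pochhammer (c + 1) (Suc m) = (c + 1) * q"
      by (simp add: pochhammer_rec q_def add.assoc)
    have 3: "pochhammer (c + 1) m = (c + 1) * q / (c + 1 + real m)"
      using 2 c by (simp add: pochhammer_Suc field_simps)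
    have "f c (Suc m) = t ^ Suc m * (c + 1 + real m) / (fact (Suc m) * (c * (c + 1) * q))"
      unfolding f_def 1 3 using c by (simp add: field_simps)
    moreover have "f (c + 1) (Suc m) = t ^ Suc m * c / (fact (Suc m) * (c * (c + 1) * q))"
      unfolding f_def 2 using c by simp
    ultimately have "f c (Suc m) - f (c + 1) (Suc m)
        = t ^ Suc m * (real m + 1) / (fact (Suc m) * (c * (c + 1) * q))"
      by (simp add: diff_divide_distrib[symmetric] algebra_simps)
    also have "\<dots> = t / (c * (c + 1)) * f (c + 2) m"
    proof -
      have "t * r * k / (k * F * (c * d * q)) = t / (c * d) * (r / (F * q))"
        if "k \<noteq> 0" "F \<noteq> 0" "d \<noteq> 0" for k F d r :: real
        using that c q by (simp add: field_simps)
      from this[of "real m + 1" "fact m" "c + 1" "t ^ m"] show ?thesis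
        unfolding f_def q_def[symmetric] using c by (simp add: add.commute)
    qed
    finally show ?thesis .
  qed
  have "(\<lambda>m. f c (Suc m) - f (c + 1) (Suc m)) sums (t / (c * (c + 1)) * hyp01 (c + 2) t)"
    unfolding term_eq using c by (intro sums_mult sums) auto
  \<comment> \<open>Both series start with 1, so the difference vanishes at index 0 and the shift
    leaves the sum unchanged.\<close>
  then have "(\<lambda>m. f c m - f (c + 1) m) sums (t / (c * (c + 1)) * hyp01 (c + 2) t)"
    by (subst (asm) sums_Suc_iff) (simp add: f_def)
  moreover have "(\<lambda>m. f c m - f (c + 1) m) sums (hyp01 c t - hyp01 (c + 1) t)"
    using c by (intro sums_diff sums) auto
  ultimately show ?thesis using sums_unique2 by fastforce
qed

text \<open>
  In the tangent case \<open>t\<close> is negative and all partial quotients being positive forces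
  \<open>p \<ge> 3\<close>, \<open>u \<ge> 2\<close>, \<open>v \<ge> 1\<close>, hence \<open>\<bar>t\<bar> = 1 / (4 p\<^sup>2 u v) \<le> 1 / 72\<close>.
\<close>

lemma hyp01_bounds:
  assumes c: "c \<ge> 1 / 2" and t: "\<bar>t\<bar> \<le> 1 / 72"
  shows "hyp01 c t \<in> {34 / 35..36 / 35}"
proof -
  define f where "f m = t ^ m / (fact m * pochhammer c m)" for m
  have summable: "summable f" unfolding f_def using c by (intro summable_hyp01) auto
  \<comment> \<open>For \<open>c \<ge> 1 / 2\<close> each new factor
    \<open>(m + 1) * (c + m)\<close> is at least 1/2. The terms are therefore at most
    \<open>(1 / 36) ^ m\<close>, and all but the first sum to at most 1/35.\<close>
  have denom: "(1 / 2) ^ m \<le> fact m * pochhammer c m" for m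
  proof (induction m)
    case (Suc m)
    have "1 * (1 / 2) \<le> (real m + 1) * (c + real m)" using c by (intro mult_mono) auto
    then have "(1 / 2) ^ m * (1 / 2) \<le> (fact m * pochhammer c m) * ((real m + 1) * (c + real m))"
      using Suc c by (intro mult_mono) (auto intro!: mult_nonneg_nonneg pochhammer_nonneg)
    then show ?case by (simp add: pochhammer_Suc algebra_simps)
  qed auto
  have bound: "norm (f m) \<le> (1 / 36) ^ m" for m
  proof -
    have "norm (f m) = \<bar>t\<bar> ^ m / (fact m * pochhammer c m)"
      unfolding f_def using c pochhammer_pos[of c m] by (simp add: abs_mult power_abs)
    also have "\<dots> \<le> (1 / 72) ^ m / (1 / 2) ^ m"
      using t denom[of m] by (intro frac_le power_mono) auto
    also have "\<dots> = (1 / 36) ^ m" by (simp flip: power_divide)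
    finally show ?thesis .
  qed
  have geo: "(\<lambda>m. (1 / 36) ^ Suc m :: real) sums (1 / 35)"
    using sums_mult[OF geometric_sums[of "1 / 36 :: real"], of "1 / 36"] by simp
  have "norm (\<Sum>m. f (Suc m)) \<le> (\<Sum>m. (1 / 36) ^ Suc m)"
    using bound sums_summable[OF geo] by (rule norm_suminf_le)
  moreover have "hyp01 c t = 1 + (\<Sum>m. f (Suc m))"
  proof -
    have "hyp01 c t = suminf f" by (simp add: hyp01_def f_def[abs_def])
    also have "\<dots> = f 0 + (\<Sum>m. f (Suc m))" using suminf_split_head[OF summable] by simp
    finally show ?thesis by (simp add: f_def)
  qed
  ultimately show ?thesis using sums_unique[OF geo] by (simp add: abs_le_iff)
qed

text \<open>For positive \<open>\<nu>\<close> and \<open>t\<close> this is \<open>sqrt t\<close>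
  times the quotient of the Bessel functions of orders \<open>\<nu> - 1\<close> and
  \<open>\<nu>\<close> at \<open>2 * sqrt t\<close>. The factor \<open>\<nu>\<close> normalises the
  contiguous relation.\<close>

definition hyp01_quot :: "real \<Rightarrow> real \<Rightarrow> real" where
  "hyp01_quot \<nu> t = \<nu> * hyp01 \<nu> t / hyp01 (\<nu> + 1) t"

lemma hyp01_quot_pos: "\<nu> > 0 \<Longrightarrow> t > 0 \<Longrightarrow> hyp01_quot \<nu> t > 0"
  by (auto simp: hyp01_quot_def intro!: divide_pos_pos mult_pos_pos hyp01_pos)

text \<open>Replaces \<open>hyp01_quot_pos\<close> when \<open>t\<close> may be negative; it also
  bounds the tails from above there. The constant is \<open>(34 / 35) / (36 / 35)\<close>.\<close>

lemma hyp01_quot_lower_bound: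
  assumes "\<nu> \<ge> 1 / 2" "\<bar>t\<bar> \<le> 1 / 72"
  shows "hyp01_quot \<nu> t \<ge> 17 / 18 * \<nu>"
proof -
  have "hyp01 \<nu> t \<ge> 34 / 35" "hyp01 (\<nu> + 1) t \<ge> 34 / 35" "hyp01 (\<nu> + 1) t \<le> 36 / 35"
    using hyp01_bounds[of \<nu> t] hyp01_bounds[of "\<nu> + 1" t] assms by auto
  then have "hyp01 \<nu> t / hyp01 (\<nu> + 1) t \<ge> (34 / 35) / (36 / 35)" by (intro frac_le) auto
  then have "\<nu> * (hyp01 \<nu> t / hyp01 (\<nu> + 1) t) \<ge> \<nu> * (17 / 18)"
    using assms by (intro mult_left_mono) auto
  then show ?thesis by (simp add: hyp01_quot_def)
qed

lemma hyp01_quot_rec: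
  assumes "\<nu> > 0" "hyp01 (\<nu> + 1) t > 0"
  shows "hyp01_quot \<nu> t = \<nu> + t / hyp01_quot (\<nu> + 1) t"
proof -
  have "hyp01_quot \<nu> t = \<nu> * (hyp01 (\<nu> + 1) t + t / (\<nu> * (\<nu> + 1)) * hyp01 (\<nu> + 2) t) / hyp01 (\<nu> + 1) t"
    unfolding hyp01_quot_def by (subst hyp01_contiguous) (use assms in auto)
  also have "\<dots> = \<nu> + t * hyp01 (\<nu> + 2) t / ((\<nu> + 1) * hyp01 (\<nu> + 1) t)"
  proof -
    have "\<nu> * (h\<^sub>1 + t / (\<nu> * d) * h\<^sub>2) / h\<^sub>1 = \<nu> + t * h\<^sub>2 / (d * h\<^sub>1)"
      if "d \<noteq> 0" "h\<^sub>1 \<noteq> 0" for d h\<^sub>1 h\<^sub>2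
      using assms(1) that by (simp add: field_simps)
    then show ?thesis using assms by simp
  qed
  \<comment> \<open>If \<open>hyp01 (\<nu> + 2) t = 0\<close>, both fractions are 0 by the
    convention for division by zero.\<close>
  also have "\<dots> = \<nu> + t / hyp01_quot (\<nu> + 1) t"
    by (simp add: hyp01_quot_def add.assoc)
  finally show ?thesis .
qed

section \<open>Elementary values at \<open>\<nu> = 1 / 2\<close>\<close>

lemma fact_pochhammer_half: "fact m * pochhammer (1 / 2 :: real) m = fact (2 * m) / 4 ^ m"
  by (simp add: fact_double power_mult)

lemma fact_pochhammer_three_halves:
  "fact m * pochhammer (3 / 2 :: real) m = fact (2 * m + 1) / 4 ^ m"
proof -
  have "pochhammer (1 / 2 :: real) (Suc m) = 1 / 2 * pochhammer (3 / 2) m"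
    by (simp add: pochhammer_rec)
  then have "pochhammer (3 / 2 :: real) m = (2 * real m + 1) * pochhammer (1 / 2) m"
    by (simp add: pochhammer_Suc algebra_simps)
  then have "fact m * pochhammer (3 / 2 :: real) m
      = (2 * real m + 1) * (fact m * pochhammer (1 / 2 :: real) m)"
    by simp
  also have "\<dots> = (2 * real m + 1) * (fact (2 * m) / 4 ^ m)" by (simp only: fact_pochhammer_half)
  also have "\<dots> = fact (2 * m + 1) / 4 ^ m" by simp
  finally show ?thesis .
qed

lemma hyp01_half_eq_cos: "hyp01 (1 / 2) (- (z\<^sup>2 / 4)) = cos z"
proof -
  have minus_pow: "(- (z\<^sup>2 / 4)) ^ m = (- 1) ^ m * (z\<^sup>2 / 4) ^ m" for m
    by (rule power_minus)
  have "(- (z\<^sup>2 / 4)) ^ m / (fact m * pochhammer (1 / 2) m) = (- 1) ^ m / fact (2 * m) * z ^ (2 * m)" for m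
    by (simp only: fact_pochhammer_half minus_pow) (simp add: power_divide power_mult)
  then show ?thesis unfolding hyp01_def using cos_paired[of z] by (simp add: sums_iff)
qed

lemma hyp01_three_halves_eq_sin: "z * hyp01 (3 / 2) (- (z\<^sup>2 / 4)) = sin z"
proof -
  have minus_pow: "(- (z\<^sup>2 / 4)) ^ m = (- 1) ^ m * (z\<^sup>2 / 4) ^ m" for m
    by (rule power_minus)
  have "z * ((- (z\<^sup>2 / 4)) ^ m / (fact m * pochhammer (3 / 2) m))
      = (- 1) ^ m / fact (2 * m + 1) * z ^ (2 * m + 1)" for m
    by (simp only: fact_pochhammer_three_halves minus_pow)
       (simp add: power_divide power_mult)
  moreover have "z * hyp01 (3 / 2) (- (z\<^sup>2 / 4))
      = (\<Sum>m. z * ((- (z\<^sup>2 / 4)) ^ m / (fact m * pochhammer (3 / 2) m)))"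
    unfolding hyp01_def by (intro suminf_mult[symmetric] summable_hyp01) auto
  ultimately show ?thesis using sin_paired[of z] by (simp add: sums_iff)
qed

lemma hyp01_half_eq_cosh: "hyp01 (1 / 2) (z\<^sup>2 / 4) = cosh z"
proof -
  have "(\<lambda>m. if even (2 * m) then z ^ (2 * m) /\<^sub>R fact (2 * m) else 0) sums cosh z"
    using cosh_converges[of z]
    by (subst sums_mono_reindex[of "\<lambda>m. 2 * m"]) (auto simp: strict_mono_def elim!: evenE)
  moreover have "(z\<^sup>2 / 4) ^ m / (fact m * pochhammer (1 / 2) m) = z ^ (2 * m) /\<^sub>R fact (2 * m)" for m
    by (simp add: fact_pochhammer_half power_divide power_mult[of z 2, symmetric] field_simps)
  ultimately show ?thesis unfolding hyp01_def by (simp add: sums_iff)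
qed

lemma hyp01_three_halves_eq_sinh: "z * hyp01 (3 / 2) (z\<^sup>2 / 4) = sinh z"
proof -
  have "(\<lambda>m. if even (2 * m + 1) then 0 else z ^ (2 * m + 1) /\<^sub>R fact (2 * m + 1)) sums sinh z"
    using sinh_converges[of z]
    by (subst sums_mono_reindex[of "\<lambda>m. 2 * m + 1"]) (auto simp: strict_mono_def elim!: oddE)
  moreover have "z * ((z\<^sup>2 / 4) ^ m / (fact m * pochhammer (3 / 2) m))
      = z ^ (2 * m + 1) /\<^sub>R fact (2 * m + 1)" for m
    by (simp only: fact_pochhammer_three_halves)
       (simp add: power_divide power_mult[of z 2, symmetric] field_simps)
  moreover have "z * hyp01 (3 / 2) (z\<^sup>2 / 4)
      = (\<Sum>m. z * ((z\<^sup>2 / 4) ^ m / (fact m * pochhammer (3 / 2) m)))"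
    unfolding hyp01_def by (intro suminf_mult[symmetric] summable_hyp01) auto
  ultimately show ?thesis by (simp add: sums_iff)
qed

lemma tan_eq_hyp01_quot: "tan z = z / 2 / hyp01_quot (1 / 2) (- (z\<^sup>2 / 4))"
  using hyp01_three_halves_eq_sin[of z]
  by (simp add: tan_def hyp01_quot_def hyp01_half_eq_cos)

lemma tanh_eq_hyp01_quot: "tanh z = z / 2 / hyp01_quot (1 / 2) (z\<^sup>2 / 4)"
  using hyp01_three_halves_eq_sinh[of z]
  by (simp add: tanh_def hyp01_quot_def hyp01_half_eq_cosh)

section \<open>Modified Bessel functions\<close>

text \<open>Factoring out the leading term turns \<open>Gamma (\<nu> + m + 1)\<close> into a
  Pochhammer symbol; the range of \<open>\<nu>\<close> keeps away from the poles and includes the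
  order \<open>a / b - 1\<close>.\<close>

lemma bessel_I_eq_hyp01:
  assumes "\<nu> > - 1" "z > 0"
  shows "bessel_I \<nu> z = (z / 2) powr \<nu> / Gamma (\<nu> + 1) * hyp01 (\<nu> + 1) (z\<^sup>2 / 4)"
proof -
  have pole: "\<nu> + 1 \<notin> \<int>\<^sub>\<le>\<^sub>0" using assms by (auto elim!: nonpos_Ints_cases)
  have gpos: "Gamma (\<nu> + 1) > 0" using assms by (intro Gamma_real_pos) auto
  have "(z / 2) powr (\<nu> + 2 * real m) / (Gamma (real m + 1) * Gamma (\<nu> + real m + 1))
     = (z / 2) powr \<nu> / Gamma (\<nu> + 1) * ((z\<^sup>2 / 4) ^ m / (fact m * pochhammer (\<nu> + 1) m))" for m
  proof -
    have "(z / 2) powr (\<nu> + 2 * real m) = (z / 2) powr \<nu> * (z / 2) powr real (2 * m)"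
      by (simp add: powr_add)
    also have "(z / 2) powr real (2 * m) = (z / 2) ^ (2 * m)"
      using assms by (intro powr_realpow) auto
    also have "\<dots> = (z\<^sup>2 / 4) ^ m" by (simp add: power_mult power_divide)
    finally have 1: "(z / 2) powr (\<nu> + 2 * real m) = (z / 2) powr \<nu> * (z\<^sup>2 / 4) ^ m" .
    have 2: "Gamma (real m + 1) = fact m" by (simp add: Gamma_fact add.commute)
    have 3: "Gamma (\<nu> + real m + 1) = pochhammer (\<nu> + 1) m * Gamma (\<nu> + 1)"
      using pochhammer_Gamma[OF pole, of m] gpos by (simp add: add_ac)
    show ?thesis unfolding 1 2 3 by simp
  qed
  then show ?thesis
    unfolding bessel_I_def hyp01_def using assms
    by (simp only: suminf_mult[OF summable_hyp01])
qed

lemma bessel_I_quot: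
  assumes "\<nu> > 0" "z > 0"
  shows "bessel_I \<nu> z / bessel_I (\<nu> - 1) z = z / 2 / hyp01_quot \<nu> (z\<^sup>2 / 4)"
proof -
  have pole: "\<nu> \<notin> \<int>\<^sub>\<le>\<^sub>0" using assms by (auto elim!: nonpos_Ints_cases)
  define P where "P = (z / 2) powr (\<nu> - 1)"
  have 1: "bessel_I (\<nu> - 1) z = P / Gamma \<nu> * hyp01 \<nu> (z\<^sup>2 / 4)"
    using bessel_I_eq_hyp01[of "\<nu> - 1" z] assms by (simp add: P_def)
  have "(z / 2) powr \<nu> = P * (z / 2)" using assms by (simp add: P_def powr_diff)
  moreover have "Gamma (\<nu> + 1) = \<nu> * Gamma \<nu>" using Gamma_plus1[OF pole] .
  ultimately have 2: "bessel_I \<nu> z = P * (z / 2) / (\<nu> * Gamma \<nu>) * hyp01 (\<nu> + 1) (z\<^sup>2 / 4)"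
    using bessel_I_eq_hyp01[of \<nu> z] assms by (simp only:)
  have "Gamma \<nu> \<noteq> 0" using pole by (simp add: Gamma_eq_zero_iff)
  moreover have "hyp01 \<nu> (z\<^sup>2 / 4) > 0" using assms by (auto intro!: hyp01_pos)
  moreover have "P > 0" using assms by (simp add: P_def)
  ultimately show ?thesis unfolding 1 2 hyp01_quot_def using assms by simp
qed

text \<open>An equivalence transformation of the continued fraction: the scale factors
  \<open>\<alpha>\<close> and \<open>\<beta>\<close>, used alternately, normalise the partial
  numerators to \<open>\<sigma>\<close>, which is 1 or -1 in every use.\<close>

lemma hyp01_quot_rec_scaled:
  assumes "\<nu> > 0" "hyp01 (\<nu> + 1) t > 0" "\<beta> \<noteq> 0" "\<alpha> * \<beta> * t = \<sigma>"
  shows "\<alpha> * hyp01_quot \<nu> t = \<alpha> * \<nu> + \<sigma> / (\<beta> * hyp01_quot (\<nu> + 1) t)"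
  unfolding hyp01_quot_rec[OF assms(1,2)] assms(4)[symmetric]
  using assms(3) by (simp add: distrib_left)

section \<open>Evaluation of the blocks\<close>

lemma entries_ge_1:
  assumes "\<And>n. f n \<noteq> []" "cf_positive (a ## overlined f)"
  shows "\<forall>x\<in>set (f n). x \<ge> 1"
  using assms by (force simp: cf_positive_SCons sset_overlined)

lemma entries_ge_1':
  assumes "\<And>n. f n \<noteq> []" "cf_positive (a ## q ## overlined f)"
  shows "\<forall>x\<in>set (f n). x \<ge> 1"
  using assms by (force simp: cf_positive_SCons sset_overlined)

section \<open>Removal of minus signs from continued fractions\<close>

lemma cf_append_minus_one_one:
  assumes "of_int A + 1 / y \<noteq> 0" "of_int A + 1 / y \<noteq> 1"
  shows "cf_append [q - 1, 1, A - 1] y = of_int q - 1 / (of_int A + 1 / y)"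
proof -
  define r where "r = of_int A + 1 / y"
  have r: "of_int A - 1 + 1 / y = r - 1" by (simp add: r_def)
  moreover have "of_int (q - 1) + 1 / (1 + 1 / (r - 1)) = of_int q - 1 / r"
    using assms unfolding r_def[symmetric] by (simp add: divide_simps left_diff_distrib)
  ultimately show ?thesis by (simp add: r flip: r_def)
qed

text \<open>The same rule with the leading entry \<open>q - 1\<close> stripped off, for blocks that
  start just after it.\<close>

lemma cf_append_one_minus_one:
  assumes "of_int A + 1 / y' \<noteq> 0" "of_int A + 1 / y' \<noteq> 1" "y = of_int q - 1 / (of_int A + 1 / y')"
  shows "cf_append [1, A - 1] y' = 1 / (y - (of_int q - 1))"
proof -
  define r where "r = of_int A + 1 / y'"
  have r: "of_int A - 1 + 1 / y' = r - 1" by (simp add: r_def)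
  moreover have "1 + 1 / (r - 1) = 1 / (1 - 1 / r)"
    using assms unfolding r_def[symmetric] by (simp add: divide_simps)
  ultimately show ?thesis by (simp add: r assms(3) flip: r_def)
qed

text \<open>The minus sign is removed at the cost of lowering the leading entry of \<open>y\<close>
  by one.\<close>

lemma cf_append_minus_one_one_shift:
  assumes "y \<noteq> 0" "y \<noteq> 1"
  shows "cf_append [B - 1, 1] (y - 1) = of_int B - 1 / y"
  using assms by (simp add: divide_simps left_diff_distrib)

text \<open>The next block begins just after the entry \<open>q - 1\<close> of the tail
  \<open>y\<close>; lowering \<open>y\<close> by one to absorb the minus sign leaves
  \<open>q - 2\<close> as the last entry of the current block.\<close>

lemma cf_append_minus_one_one_minus_two:
  assumes "y \<noteq> 0" "y \<noteq> 1"
  shows "cf_append [B - 1, 1, q - 2] (1 / (y - (of_int q - 1))) = of_int B - 1 / y"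
proof -
  have "cf_append [q - 2] (1 / (y - (of_int q - 1))) = y - 1" by simp
  then show ?thesis using cf_append_minus_one_one_shift[OF assms, of B] by simp
qed

text \<open>The conjugation by \<open>w = p / y - 1\<close>. It is stated over the reals and without
  sign conditions on \<open>A\<close>, \<open>w\<close> and \<open>w'\<close>, since the later
  expansions apply it with negative values.\<close>

lemma tail_step:
  fixes p A w w' :: real
  assumes "p \<noteq> 0" "w \<noteq> - 1" "w * (p * A + w') = 1"
  shows "p - 1 / (A + (1 + w') / p) = p / (1 + w)"
proof -
  have "w \<noteq> 0" "1 + w \<noteq> 0" using assms by (auto simp: add_eq_0_iff)
  then have "w' = 1 / w - p * A" using assms(3) by (simp add: field_simps)
  then have eq: "A + (1 + w') / p = (1 + w) / (p * w)"
    using assms(1) \<open>w \<noteq> 0\<close> by (simp add: field_simps)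
  show ?thesis
    unfolding eq using assms(1) \<open>w \<noteq> 0\<close> \<open>1 + w \<noteq> 0\<close> by (simp add: field_simps)
qed

lemma cf_append_half_block:
  fixes w w' :: real
  assumes p: "p \<ge> 2" and A: "A \<ge> 2" and w': "w' > 0"
    and w: "w * (of_int p * of_int A + w') = 1"
  shows "cf_append [p - 1, 1, A - 1] (of_int p / (1 + w')) = of_int p / (1 + w)"
proof -
  have "of_int p * of_int A + w' > 0" using p A w' by (intro add_pos_pos mult_pos_pos) auto
  then have "w > 0" using w by (metis zero_less_mult_pos2 zero_less_one)
  have "(1 + w') / of_int p > 0" using p w' by (intro divide_pos_pos) auto
  then have "of_int A + (1 + w') / of_int p > 1" using A by linarith
  then show ?thesis
    using tail_step[of "of_int p" w "of_int A" w'] p w \<open>w > 0\<close>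
      cf_append_minus_one_one[of A "of_int p / (1 + w')" p]
    by simp
qed

section \<open>The four expansions in terms of \<open>hyp01_quot\<close>\<close>

text \<open>Serves the Bessel expansion and, with \<open>a = 1\<close> and \<open>b = 2\<close>, the
  hyperbolic tangent; hence the value is left in terms of \<open>hyp01_quot\<close>.\<close>

lemma has_value_hyp01_quot:
  fixes a b p u v :: int
  defines "f \<equiv> \<lambda>n. [p - 1, 1, u * (a + 2 * int n * b) - 1, p - 1, 1, v * (a + (2 * int n + 1) * b) - 1]"
  assumes b: "b > 0" and pos: "cf_positive (0 ## overlined f)"
  shows "p \<ge> 2" "a > 0" "u > 0" "v > 0"
    and "cf_has_value (0 ## overlined f) (1 / of_int p + 1 / of_int p *
      (1 / (of_int p * of_int u * of_int b *
        hyp01_quot (of_int a / of_int b) (1 / (of_int b ^ 2 * of_int p ^ 2 * of_int u * of_int v)))))"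
proof -
  have f_nonempty: "f n \<noteq> []" for n by (simp add: f_def)
  have entries: "\<forall>x\<in>set (f n). x \<ge> 1" for n using entries_ge_1[OF f_nonempty pos] .
  have A: "u * (a + 2 * int n * b) \<ge> 2" for n using entries[of n] by (simp add: f_def)
  have B: "v * (a + (2 * int n + 1) * b) \<ge> 2" for n using entries[of n] by (simp add: f_def)
  show p: "p \<ge> 2" using entries[of 0] by (simp add: f_def)
  \<comment> \<open>The entry at \<open>n = 0\<close> only shows that \<open>u\<close> and
    \<open>a\<close> have the same sign. At \<open>n = \<bar>a\<bar>\<close> the second factor is
    nonnegative for either sign of \<open>a\<close>, which settles the sign of
    \<open>u\<close>.\<close>
  have "\<bar>a\<bar> * 1 \<le> \<bar>a\<bar> * b" using b by (intro mult_left_mono) auto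
  then have "a + 2 * int (nat \<bar>a\<bar>) * b \<ge> 0" by simp
  moreover have "0 < u * (a + 2 * int (nat \<bar>a\<bar>) * b)" using A[of "nat \<bar>a\<bar>"] by linarith
  ultimately show u: "u > 0" unfolding zero_less_mult_iff by linarith
  have "0 < u * a" using A[of 0] by simp
  with u show a: "a > 0" by (simp add: zero_less_mult_iff)
  have "0 < v * (a + b)" using B[of 0] by simp
  with a b show v: "v > 0" by (auto simp: zero_less_mult_iff)
  define t :: real where "t = 1 / (of_int b ^ 2 * of_int p ^ 2 * of_int u * of_int v)"
  define \<nu> :: "nat \<Rightarrow> real" where "\<nu> n = of_int a / of_int b + 2 * real n" for n
  define w where "w n = 1 / (of_int p * of_int u * of_int b * hyp01_quot (\<nu> n) t)" for n
  define w' where "w' n = 1 / (of_int p * of_int v * of_int b * hyp01_quot (\<nu> n + 1) t)" for n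
  have t: "t > 0" using b p u v by (simp add: t_def)
  have \<nu>: "\<nu> n > 0" for n using a b by (auto simp: \<nu>_def intro!: add_pos_nonneg)
  have R_pos: "hyp01_quot (\<nu> n) t > 0" "hyp01_quot (\<nu> n + 1) t > 0" for n
    using \<nu>[of n] t by (auto intro!: hyp01_quot_pos)
  have w: "w n > 0" "w' n > 0" for n using R_pos[of n] b p u v by (auto simp: w_def w'_def)
  have \<nu>_Suc: "\<nu> (Suc n) = \<nu> n + 2" for n by (simp add: \<nu>_def)
  \<comment> \<open>The scale factors are \<open>p * u * b\<close> and \<open>p * v * b\<close>;
    their product with \<open>t\<close> is 1. A period uses two steps of the recursion, so
    \<open>\<nu>\<close> grows by 2.\<close>
  have step: "w n * (of_int p * of_int (u * (a + 2 * int n * b)) + w' n) = 1" for n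
  proof -
    have "of_int p * of_int u * of_int b * hyp01_quot (\<nu> n) t
        = of_int p * of_int u * of_int b * \<nu> n + w' n"
      unfolding w'_def
      by (rule hyp01_quot_rec_scaled)
        (use \<nu>[of n] t b p u v in \<open>auto intro!: hyp01_pos simp: t_def power2_eq_square\<close>)
    also have "of_int p * of_int u * of_int b * \<nu> n = of_int p * of_int (u * (a + 2 * int n * b))"
      using b by (simp add: \<nu>_def field_simps)
    finally show ?thesis using w[of n] by (auto simp: w_def)
  qed
  have step': "w' n * (of_int p * of_int (v * (a + (2 * int n + 1) * b)) + w (Suc n)) = 1" for n
  proof -
    have "of_int p * of_int v * of_int b * hyp01_quot (\<nu> n + 1) t
        = of_int p * of_int v * of_int b * (\<nu> n + 1) + 1 / (of_int p * of_int u * of_int b * hyp01_quot (\<nu> n + 1 + 1) t)"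
      by (rule hyp01_quot_rec_scaled)
        (use \<nu>[of n] t b p u v in \<open>auto intro!: hyp01_pos simp: t_def power2_eq_square\<close>)
    also have "of_int p * of_int v * of_int b * (\<nu> n + 1) = of_int p * of_int (v * (a + (2 * int n + 1) * b))"
      using b by (simp add: \<nu>_def field_simps)
    also have "1 / (of_int p * of_int u * of_int b * hyp01_quot (\<nu> n + 1 + 1) t) = w (Suc n)"
      by (simp add: w_def \<nu>_Suc add.assoc)
    finally show ?thesis using w(2)[of n] by (auto simp: w'_def)
  qed
  define y where "y n = of_int p / (1 + w n)" for n
  have y: "y n > 0" for n using w(1)[of n] p by (simp add: y_def add_pos_pos)
  have "y n = cf_append (f n) (y (Suc n))" for n
  proof -
    have "f n = [p - 1, 1, u * (a + 2 * int n * b) - 1]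
        @ [p - 1, 1, v * (a + (2 * int n + 1) * b) - 1]"
      by (simp add: f_def)
    then show ?thesis
      using cf_append_half_block[OF p A w(2) step] cf_append_half_block[OF p B w(1) step']
      by (simp only: foldr_append o_apply y_def)
  qed
  then have "expands (overlined f) (y 0)"
    by (rule expands_overlined[of f y, OF f_nonempty entries y])
  then have "cf_has_value (0 ## overlined f) (of_int 0 + 1 / y 0)"
    using y[of 0] by (intro cf_has_value_SCons expands_has_value) auto
  also have "of_int 0 + 1 / y 0 = 1 / of_int p + 1 / of_int p * w 0"
    by (simp add: y_def add_divide_distrib)
  finally show "cf_has_value (0 ## overlined f) (1 / of_int p + 1 / of_int p *
      (1 / (of_int p * of_int u * of_int b *
        hyp01_quot (of_int a / of_int b) (1 / (of_int b ^ 2 * of_int p ^ 2 * of_int u * of_int v)))))"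
    by (simp add: w_def \<nu>_def t_def)
qed

text \<open>
  In the expansions starting with \<open>0, p - 1\<close>, the natural tail \<open>y = p / (1 + w)\<close> begins one
  entry before the block, hence the reciprocal of \<open>y - (p - 1)\<close>.
\<close>

lemma has_value_shifted:
  fixes p :: int and w :: "nat \<Rightarrow> real"
  assumes nonempty: "\<And>n. f n \<noteq> []" and entries: "\<And>n. \<forall>x\<in>set (f n). x \<ge> 1"
    and p: "p \<ge> 3" and w: "\<And>n. w n > 0" "\<And>n. w n < 1 / (of_int p - 1)"
    and step: "\<And>n. cf_append (f n) (1 / (of_int p / (1 + w (Suc n)) - (of_int p - 1)))
      = 1 / (of_int p / (1 + w n) - (of_int p - 1))"
  shows "cf_has_value (0 ## (p - 1) ## overlined f) (1 / of_int p + 1 / of_int p * w 0)"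
proof -
  define y where "y n = 1 / (of_int p / (1 + w n) - (of_int p - 1))" for n
  have y: "y n > 0" for n
  proof -
    \<comment> \<open>This inequality says exactly that \<open>p / (1 + w n)\<close> exceeds the
      entry \<open>p - 1\<close>.\<close>
    have "w n * (of_int p - 1) < 1" using w(2)[of n] p by (simp add: field_simps)
    then have "of_int p / (1 + w n) > of_int p - 1" using w(1)[of n] by (simp add: field_simps)
    then show ?thesis by (simp add: y_def)
  qed
  have "expands (overlined f) (y 0)"
    using step unfolding y_def[symmetric]
    by (intro expands_overlined[of f y, OF nonempty entries y]) (rule sym)
  then have "cf_has_value ((p - 1) ## overlined f) (of_int (p - 1) + 1 / y 0)"
    using y[of 0] by (intro cf_has_value_SCons expands_has_value) auto
  also have "of_int (p - 1) + 1 / y 0 = of_int p / (1 + w 0)" by (simp add: y_def)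
  finally have "cf_has_value (0 ## (p - 1) ## overlined f) (of_int 0 + 1 / (of_int p / (1 + w 0)))"
    using w(1)[of 0] p by (intro cf_has_value_SCons) auto
  then show ?thesis by (simp add: add_divide_distrib)
qed

lemma has_value_tan:
  fixes p u v :: int
  defines "f \<equiv> \<lambda>n. [1, (4 * int n + 1) * u - 1, p, (4 * int n + 3) * v - 1, 1, p - 2]"
  assumes pos: "cf_positive (0 ## (p - 1) ## overlined f)"
  shows "p \<ge> 3" "u > 0" "v > 0"
    and "cf_has_value (0 ## (p - 1) ## overlined f) (1 / of_int p + 1 / of_int p *
      (1 / (2 * of_int p * of_int u *
        hyp01_quot (1 / 2) (- (1 / (4 * of_int p ^ 2 * of_int u * of_int v))))))"
proof -
  have f_nonempty: "f n \<noteq> []" for n by (simp add: f_def)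
  have entries: "\<forall>x\<in>set (f n). x \<ge> 1" for n using entries_ge_1'[OF f_nonempty pos] .
  have A: "(4 * int n + 1) * u \<ge> 2" for n using entries[of n] by (simp add: f_def)
  have B: "(4 * int n + 3) * v \<ge> 2" for n using entries[of n] by (simp add: f_def)
  show p: "p \<ge> 3" using entries[of 0] by (simp add: f_def)
  show u: "u > 0" using A[of 0] by simp
  show v: "v > 0" using B[of 0] by simp
  define t :: real where "t = - (1 / (4 * of_int p ^ 2 * of_int u * of_int v))"
  define \<nu> :: "nat \<Rightarrow> real" where "\<nu> n = 1 / 2 + 2 * real n" for n
  define w where "w n = 1 / (2 * of_int p * of_int u * hyp01_quot (\<nu> n) t)" for n
  define w' where "w' n = 1 / (2 * of_int p * of_int v * hyp01_quot (\<nu> n + 1) t)" for n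
  have t: "\<bar>t\<bar> \<le> 1 / 72"
  proof -
    have "(4 * 3 ^ 2 * 2 * 1 :: real) \<le> 4 * of_int p ^ 2 * of_int u * of_int v"
      using p v A[of 0] by (intro mult_mono power_mono) auto
    then show ?thesis unfolding t_def by (simp add: field_simps)
  qed
  have t_eq: "2 * of_int p * of_int u * (2 * of_int p * of_int v) * t = - 1"
    using p u v by (simp add: t_def power2_eq_square)
  have hyp01: "hyp01 r t > 0" if "r \<ge> 1 / 2" for r using hyp01_bounds[OF that t] by auto
  have \<nu>: "\<nu> n \<ge> 1 / 2" for n by (simp add: \<nu>_def)
  have \<nu>_Suc: "\<nu> (Suc n) = \<nu> n + 2" for n by (simp add: \<nu>_def)
  have R: "hyp01_quot (\<nu> n) t \<ge> 17 / 36" "hyp01_quot (\<nu> n + 1) t \<ge> 17 / 36" for n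
  proof -
    have *: "hyp01_quot r t \<ge> 17 / 36" if "r \<ge> 1 / 2" for r
      using hyp01_quot_lower_bound[OF that t] that by linarith
    show "hyp01_quot (\<nu> n) t \<ge> 17 / 36" by (rule *[OF \<nu>])
    show "hyp01_quot (\<nu> n + 1) t \<ge> 17 / 36" by (rule *) (use \<nu>[of n] in linarith)
  qed
  have w_pos: "w n > 0" "w' n > 0" for n
    using R[of n] p u v by (auto simp: w_def w'_def intro!: divide_pos_pos mult_pos_pos)
  \<comment> \<open>Since \<open>u \<ge> 2\<close>, the denominator of \<open>w n\<close> is at
    least \<open>17 / 9 * p\<close>.\<close>
  have w_less: "w n < 1 / (of_int p - 1)" for n
  proof -
    have "of_int p * 2 * (2 * (17 / 36)) \<le> of_int p * of_int u * (2 * hyp01_quot (\<nu> n) t)"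
      using R[of n] p u A[of 0] by (intro mult_mono) auto
    also have "\<dots> = 2 * of_int p * of_int u * hyp01_quot (\<nu> n) t" by simp
    finally have "of_int p - 1 < 2 * of_int p * of_int u * hyp01_quot (\<nu> n) t"
      using p by linarith
    then show ?thesis unfolding w_def using p by (intro frac_less2) auto
  qed
  \<comment> \<open>Keeps the intermediate tail \<open>p / (1 - w' n)\<close> positive; the
    denominator of \<open>w' n\<close> is at least 17/6.\<close>
  have w'_less: "w' n < 1" for n
  proof -
    have "3 * 1 * (2 * (17 / 36)) \<le> of_int p * of_int v * (2 * hyp01_quot (\<nu> n + 1) t)"
      using R[of n] p v by (intro mult_mono) auto
    then show ?thesis unfolding w'_def by (simp add: mult_ac)
  qed
  have step: "w n * (of_int p * of_int ((4 * int n + 1) * u) + - w' n) = 1" for n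
  proof -
    have "2 * of_int p * of_int u * hyp01_quot (\<nu> n) t
        = 2 * of_int p * of_int u * \<nu> n + (- 1) / (2 * of_int p * of_int v * hyp01_quot (\<nu> n + 1) t)"
      by (rule hyp01_quot_rec_scaled)
        (use \<nu>[of n] p u v t_eq in \<open>auto intro!: hyp01 simp: mult_ac\<close>)
    also have "2 * of_int p * of_int u * \<nu> n = of_int p * of_int ((4 * int n + 1) * u)"
      by (simp add: \<nu>_def algebra_simps)
    finally show ?thesis using w_pos(1)[of n] by (auto simp: w_def w'_def)
  qed
  \<comment> \<open>Because \<open>p + 1 / (B - 1 / y) = p - 1 / (- B + 1 / y)\<close>,
    \<open>tail_step\<close> applies with \<open>- B\<close> and \<open>- w' n\<close>.\<close>
  have step': "- w' n * (of_int p * - of_int ((4 * int n + 3) * v) + w (Suc n)) = 1" for n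
  proof -
    have "2 * of_int p * of_int v * hyp01_quot (\<nu> n + 1) t
        = 2 * of_int p * of_int v * (\<nu> n + 1) + (- 1) / (2 * of_int p * of_int u * hyp01_quot (\<nu> n + 1 + 1) t)"
      by (rule hyp01_quot_rec_scaled)
        (use \<nu>[of n] p u v t_eq in \<open>auto intro!: hyp01 simp: mult_ac\<close>)
    also have "2 * of_int p * of_int v * (\<nu> n + 1) = of_int p * of_int ((4 * int n + 3) * v)"
      by (simp add: \<nu>_def algebra_simps)
    also have "(- 1) / (2 * of_int p * of_int u * hyp01_quot (\<nu> n + 1 + 1) t) = - w (Suc n)"
      by (simp add: w_def \<nu>_Suc add.assoc)
    finally have "of_int p * of_int ((4 * int n + 3) * v) - w (Suc n) = 1 / w' n"
      by (simp add: w'_def)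
    then show ?thesis using w_pos(2)[of n] by (simp add: algebra_simps)
  qed
  have "cf_append (f n) (1 / (of_int p / (1 + w (Suc n)) - (of_int p - 1)))
      = 1 / (of_int p / (1 + w n) - (of_int p - 1))" for n
  proof -
    define y where "y = real_of_int p / (1 + w (Suc n))"
    define y' where "y' = real_of_int p / (1 + - w' n)"
    have "1 / (real_of_int p - 1) < 1" using p by simp
    then have "w (Suc n) < 1" using w_less[of "Suc n"] by linarith
    then have y: "y > 1" using w_pos(1)[of "Suc n"] p by (simp add: y_def)
    have y': "y' = of_int p - 1 / (- of_int ((4 * int n + 3) * v) + 1 / y)"
      using tail_step[OF _ _ step'[of n]] w'_less[of n] p by (simp add: y'_def y_def)
    have y'_pos: "1 / y' > 0" using w'_less[of n] p by (simp add: y'_def)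
    have A': "real_of_int ((4 * int n + 1) * u) \<ge> 2" using A[of n] by linarith
    have "cf_append (f n) (1 / (y - (of_int p - 1))) = cf_append [1, (4 * int n + 1) * u - 1]
        (cf_append [p] (cf_append [(4 * int n + 3) * v - 1, 1, p - 2] (1 / (y - (of_int p - 1)))))"
      by (simp add: f_def)
    also have "cf_append [(4 * int n + 3) * v - 1, 1, p - 2] (1 / (y - (of_int p - 1)))
        = of_int ((4 * int n + 3) * v) - 1 / y"
      using y by (intro cf_append_minus_one_one_minus_two) auto
    also have "cf_append [p] \<dots> = of_int p - 1 / - (of_int ((4 * int n + 3) * v) - 1 / y)"
      by (simp only: foldr.simps o_apply id_apply divide_minus_right diff_minus_eq_add)
    also have "\<dots> = y'"
      unfolding y' by (simp only: minus_diff_eq uminus_add_conv_diff)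
    also have "cf_append [1, (4 * int n + 1) * u - 1] y' = 1 / (of_int p / (1 + w n) - (of_int p - 1))"
    proof (rule cf_append_one_minus_one)
      show "of_int p / (1 + w n) = of_int p - 1 / (of_int ((4 * int n + 1) * u) + 1 / y')"
        using tail_step[OF _ _ step[of n]] w_pos(1)[of n] p by (simp add: y'_def)
    qed (use y'_pos A' in linarith)+
    finally show ?thesis by (simp only: y_def)
  qed
  from has_value_shifted[where f = f, OF f_nonempty entries p w_pos(1) w_less this]
  show "cf_has_value (0 ## (p - 1) ## overlined f) (1 / of_int p + 1 / of_int p *
      (1 / (2 * of_int p * of_int u *
        hyp01_quot (1 / 2) (- (1 / (4 * of_int p ^ 2 * of_int u * of_int v))))))"
    by (simp add: w_def \<nu>_def t_def)
qed

text \<open>The product \<open>\<alpha> * hyp01_quot (1 / 2) (1 / \<alpha> ^ 2)\<close> is the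
  hyperbolic cotangent of \<open>2 / \<alpha>\<close>. Its recursion can be scaled by
  \<open>\<alpha>\<close> at every step, as \<open>\<alpha> * \<alpha> * t = 1\<close>.\<close>

lemma has_value_coth:
  fixes p u v :: int
  defines "f \<equiv> \<lambda>n. [1, (4 * int n + 1) * u - 1, p - 1, 1, 2 * v - 1, p,
           (4 * int n + 3) * u - 1, 1, p - 1, 2 * v - 1, 1, p - 2]"
    and "\<alpha> \<equiv> 4 * real_of_int u * of_int p ^ 2 * of_int v"
  assumes pos: "cf_positive (0 ## (p - 1) ## overlined f)"
  shows "p \<ge> 3" "u > 0" "v > 0"
    and "cf_has_value (0 ## (p - 1) ## overlined f) (1 / of_int p + 1 / of_int p *
      (2 * of_int p * of_int v / (1 + \<alpha> * hyp01_quot (1 / 2) (1 / \<alpha> ^ 2))))"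
proof -
  have f_nonempty: "f n \<noteq> []" for n by (simp add: f_def)
  have entries: "\<forall>x\<in>set (f n). x \<ge> 1" for n using entries_ge_1'[OF f_nonempty pos] .
  have A: "(4 * int n + 1) * u \<ge> 2" for n using entries[of n] by (simp add: f_def)
  have B: "(4 * int n + 3) * u \<ge> 2" for n using entries[of n] by (simp add: f_def)
  show p: "p \<ge> 3" using entries[of 0] by (simp add: f_def)
  show u: "u > 0" using A[of 0] by simp
  show v: "v > 0" using entries[of 0] by (simp add: f_def)
  define c :: real where "c = 2 * of_int p * of_int v"
  define t where "t = 1 / \<alpha> ^ 2"
  define \<nu> :: "nat \<Rightarrow> real" where "\<nu> n = 1 / 2 + 2 * real n" for n
  define k where "k n = \<alpha> * hyp01_quot (\<nu> n) t" for n
  define k' where "k' n = \<alpha> * hyp01_quot (\<nu> n + 1) t" for n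
  define w where "w n = c / (1 + k n)" for n
  have \<alpha>: "\<alpha> > 0" using p u v by (simp add: \<alpha>_def)
  have t: "t > 0" using \<alpha> by (simp add: t_def)
  have \<nu>: "\<nu> n > 0" for n by (simp add: \<nu>_def add_pos_nonneg)
  have \<nu>_Suc: "\<nu> (Suc n) = \<nu> n + 2" for n by (simp add: \<nu>_def)
  have k_pos: "k n > 0" "k' n > 0" for n
    using \<nu>[of n] \<alpha> t by (auto simp: k_def k'_def intro!: mult_pos_pos hyp01_quot_pos)
  have c: "c \<ge> 6"
  proof -
    have "2 * 3 * 1 \<le> c" unfolding c_def using p v by (intro mult_mono) auto
    then show ?thesis by simp
  qed
  have k: "k n = c * (of_int p * of_int ((4 * int n + 1) * u)) + 1 / k' n" for n
  proof -
    have "k n = \<alpha> * \<nu> n + 1 / k' n"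
      unfolding k_def k'_def
      by (rule hyp01_quot_rec_scaled)
        (use \<nu>[of n] \<alpha> t in \<open>auto intro!: hyp01_pos simp: t_def power2_eq_square\<close>)
    also have "\<alpha> * \<nu> n = c * (of_int p * of_int ((4 * int n + 1) * u))"
      by (simp add: \<alpha>_def c_def \<nu>_def algebra_simps power2_eq_square)
    finally show ?thesis .
  qed
  have k': "k' n = c * (of_int p * of_int ((4 * int n + 3) * u)) + 1 / k (Suc n)" for n
  proof -
    have "k' n = \<alpha> * (\<nu> n + 1) + 1 / (\<alpha> * hyp01_quot (\<nu> n + 1 + 1) t)"
      unfolding k'_def
      by (rule hyp01_quot_rec_scaled)
        (use \<nu>[of n] \<alpha> t in \<open>auto intro!: hyp01_pos simp: t_def power2_eq_square\<close>)
    also have "\<alpha> * (\<nu> n + 1) = c * (of_int p * of_int ((4 * int n + 3) * u))"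
      by (simp add: \<alpha>_def c_def \<nu>_def algebra_simps power2_eq_square)
    also have "\<alpha> * hyp01_quot (\<nu> n + 1 + 1) t = k (Suc n)"
      by (simp add: k_def \<nu>_Suc add.assoc)
    finally show ?thesis .
  qed
  have pA: "of_int p * real_of_int ((4 * int n + 1) * u) \<ge> 2 * of_int p"
    and pB: "of_int p * real_of_int ((4 * int n + 3) * u) \<ge> 2 * of_int p" for n
  proof -
    have "real_of_int ((4 * int n + 1) * u) \<ge> 2" "real_of_int ((4 * int n + 3) * u) \<ge> 2"
      using A[of n] B[of n] by linarith+
    then have "of_int p * real_of_int ((4 * int n + 1) * u) \<ge> of_int p * 2"
      "of_int p * real_of_int ((4 * int n + 3) * u) \<ge> of_int p * 2"
      using p by (intro mult_left_mono; simp)+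
    then show "of_int p * real_of_int ((4 * int n + 1) * u) \<ge> 2 * of_int p"
      "of_int p * real_of_int ((4 * int n + 3) * u) \<ge> 2 * of_int p"
      by linarith+
  qed
  \<comment> \<open>The bound \<open>1 / (2 * p)\<close> lies below both thresholds in use:
    \<open>1 / (p - 1)\<close> for the start of a block and 1 for the tails inside it.\<close>
  have c_k: "c / (1 + k n) < 1 / (2 * of_int p)" and c_k': "c / (1 + k' n) < 1 / (2 * of_int p)" for n
  proof -
    have less: "c / (1 + (c * r + s)) < 1 / (2 * of_int p)" if "r \<ge> 2 * of_int p" "s > 0" for r s
    proof -
      have "c * (2 * of_int p) \<le> c * r" using that c by (intro mult_left_mono) auto
      then have "c * (2 * of_int p) < 1 + (c * r + s)" using that by linarith
      moreover from this have "1 + (c * r + s) > 0"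
        using c p by (smt (verit) mult_nonneg_nonneg of_int_0_le_iff)
      ultimately show ?thesis using p by (simp add: field_simps)
    qed
    show "c / (1 + k n) < 1 / (2 * of_int p)"
      unfolding k[of n] by (rule less[OF pA]) (simp add: k_pos)
    show "c / (1 + k' n) < 1 / (2 * of_int p)"
      unfolding k'[of n] by (rule less[OF pB]) (simp add: k_pos)
  qed
  have w_pos: "w n > 0" for n using k_pos(1)[of n] c by (simp add: w_def)
  have half_p: "1 / (2 * real_of_int p) < 1 / (of_int p - 1)" "1 / (2 * real_of_int p) < 1"
    using p by (auto intro!: divide_strict_left_mono)
  have w_less: "w n < 1 / (of_int p - 1)" for n
    using c_k[of n] half_p by (simp add: w_def)
  have "cf_append (f n) (1 / (of_int p / (1 + w (Suc n)) - (of_int p - 1)))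
      = 1 / (of_int p / (1 + w n) - (of_int p - 1))" for n
  proof -
    \<comment> \<open>The four tails of one period, obtained by solving
      \<open>w * (p * A + w') = 1\<close> successively with the partial denominators
      \<open>p * A'\<close>, \<open>c\<close>, \<open>- p * B'\<close> and
      \<open>- c\<close>.\<close>
    define w1 where "w1 = (1 + 1 / k' n) / c"
    define w2 where "w2 = - (c / (1 + k' n))"
    define w3 where "w3 = - ((1 + 1 / k (Suc n)) / c)"
    define w4 where "w4 = w (Suc n)"
    define A' where "A' = real_of_int ((4 * int n + 1) * u)"
    define B' where "B' = real_of_int ((4 * int n + 3) * u)"
    have c_eq: "of_int p * (2 * of_int v) = c" by (simp add: c_def)
    note kp = k_pos(2)[of n] k_pos(1)[of "Suc n"] k_pos(1)[of n]
    have k_inv: "k n = c * (of_int p * A') + 1 / k' n" "k' n = c * (of_int p * B') + 1 / k (Suc n)"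
      unfolding A'_def B'_def by (rule k, rule k')
    have reciprocal_identity: "(1 + 1 / r) / c * (c + - (c / (1 + r))) = 1" if "r > 0" for r
    proof -
      have "1 + 1 / r = (1 + r) / r" "c + - (c / (1 + r)) = c * r / (1 + r)"
        using that by (simp_all add: field_simps)
      then show ?thesis using that c by simp
    qed
    have s1: "w n * (of_int p * A' + w1) = 1"
    proof -
      have "of_int p * A' + w1 = (1 + k n) / c" using k_inv(1) c by (simp add: w1_def field_simps)
      then show ?thesis using kp c by (simp add: w_def)
    qed
    have s2: "w1 * (of_int p * (2 * of_int v) + w2) = 1"
      unfolding c_eq w1_def w2_def using kp(1) c by (intro reciprocal_identity) auto
    have s3: "w2 * (of_int p * - B' + w3) = 1"
    proof -
      have "of_int p * - B' + w3 = - ((1 + k' n) / c)"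
        using k_inv(2) c by (simp add: w3_def field_simps)
      then show ?thesis using kp c by (simp add: w2_def)
    qed
    have s4: "w3 * (of_int p * - (2 * of_int v) + w4) = 1"
    proof -
      have "(1 + 1 / k (Suc n)) / c * (c + - (c / (1 + k (Suc n)))) = 1"
        using kp(2) c by (intro reciprocal_identity) auto
      then show ?thesis
        unfolding mult_minus_right c_eq w3_def w4_def w_def by (simp add: algebra_simps)
    qed
    define y1 y2 y3 y4 where "y1 = real_of_int p / (1 + w1)" and "y2 = real_of_int p / (1 + w2)"
      and "y3 = real_of_int p / (1 + w3)" and "y4 = real_of_int p / (1 + w4)"
    have w1: "w1 > 0" using kp c by (simp add: w1_def add_pos_pos)
    have w2: "w2 > - 1" "w2 < 0"
    proof -
      have "c / (1 + k' n) < 1" using c_k'[of n] half_p(2) by linarith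
      then show "w2 > - 1" unfolding w2_def by linarith
      show "w2 < 0" using kp c by (simp add: w2_def)
    qed
    have w3: "w3 > - 1" "w3 < 0"
    proof -
      \<comment> \<open>With \<open>c \<ge> 6\<close> this gives
        \<open>(1 + 1 / k (Suc n)) / c < 1 / 3\<close>, so \<open>w3\<close> stays above -1.\<close>
      have "1 / k (Suc n) < 1"
      proof -
        have "6 * (2 * 3) \<le> c * (of_int p * of_int ((4 * int (Suc n) + 1) * u))"
        proof (rule mult_mono)
          have "real_of_int p \<ge> 3" using p by simp
          then show "2 * 3 \<le> real_of_int p * of_int ((4 * int (Suc n) + 1) * u)"
            using pA[of "Suc n"] by linarith
        qed (use c in auto)
        then have "k (Suc n) > 1" unfolding k[of "Suc n"]
          using k_pos(2)[of "Suc n"] by (smt (verit) zero_less_divide_1_iff)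
        then show ?thesis by simp
      qed
      then have "(1 + 1 / k (Suc n)) / c < 1" using c by simp
      then show "w3 > - 1" by (simp add: w3_def)
      show "w3 < 0" using kp c by (simp add: w3_def add_pos_pos)
    qed
    have w4: "w4 > 0" using w_pos by (simp add: w4_def)
    have w4_less: "w4 < 1" using c_k[of "Suc n"] half_p(2) unfolding w4_def w_def by linarith
    have y1: "y1 = of_int p - 1 / (2 * of_int v + 1 / y2)"
      using tail_step[OF _ _ s2] w1 p by (simp add: y1_def y2_def)
    have y2: "y2 = of_int p - 1 / (- B' + 1 / y3)"
      using tail_step[OF _ _ s3] w2 p by (simp add: y2_def y3_def)
    have y3: "y3 = of_int p - 1 / (- (2 * of_int v) + 1 / y4)"
      using tail_step[OF _ _ s4] w3 p by (simp add: y3_def y4_def)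
    have y0: "of_int p / (1 + w n) = of_int p - 1 / (A' + 1 / y1)"
      using tail_step[OF _ _ s1] w_pos[of n] p by (simp add: y1_def)
    have pos: "y1 > 0" "y2 > 0" "y3 > 1" "y4 > 1"
      using w1 w2 w3 w4 w4_less p by (auto simp: y1_def y2_def y3_def y4_def)
    have A': "A' \<ge> 2" using A[of n] unfolding A'_def by linarith
    \<comment> \<open>Evaluated from the right, the pieces yield \<open>y3 - 1\<close>,
      \<open>y2\<close> and \<open>y1\<close>. The entry \<open>p - 1\<close> in front of
      \<open>2 * v - 1, 1, p - 2\<close> is the leading \<open>p\<close> of \<open>y3\<close>,
      lowered by the minus sign in \<open>B' - 1 / y3\<close>.\<close>
    have "cf_append (f n) (1 / (y4 - (of_int p - 1)))
      = cf_append [1, (4 * int n + 1) * u - 1] (cf_append [p - 1, 1, 2 * v - 1]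
         (cf_append [p] (cf_append [(4 * int n + 3) * u - 1, 1] (cf_append [p - 1]
            (cf_append [2 * v - 1, 1, p - 2] (1 / (y4 - (of_int p - 1))))))))"
      by (simp add: f_def)
    also have "cf_append [2 * v - 1, 1, p - 2] (1 / (y4 - (of_int p - 1))) = of_int (2 * v) - 1 / y4"
      using pos by (intro cf_append_minus_one_one_minus_two) auto
    also have "cf_append [p - 1] \<dots> = of_int p - 1 / - (2 * of_int v - 1 / y4) - 1"
      by (simp add: divide_minus_right del: minus_diff_eq)
    also have "\<dots> = y3 - 1"
      unfolding y3 by (simp only: minus_diff_eq uminus_add_conv_diff)
    also have "cf_append [(4 * int n + 3) * u - 1, 1] (y3 - 1) = B' - 1 / y3"
      unfolding B'_def using pos by (intro cf_append_minus_one_one_shift) auto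
    also have "cf_append [p] \<dots> = of_int p - 1 / - (B' - 1 / y3)"
      by (simp add: divide_minus_right del: minus_diff_eq)
    also have "\<dots> = y2"
      unfolding y2 by (simp only: minus_diff_eq uminus_add_conv_diff)
    also have "cf_append [p - 1, 1, 2 * v - 1] y2 = of_int p - 1 / (of_int (2 * v) + 1 / y2)"
    proof -
      have "1 / y2 > 0" "real_of_int (2 * v) \<ge> 2" using pos v by auto
      then show ?thesis by (intro cf_append_minus_one_one) linarith+
    qed
    also have "\<dots> = y1" unfolding y1 by simp
    also have "cf_append [1, (4 * int n + 1) * u - 1] y1 = 1 / (of_int p / (1 + w n) - (of_int p - 1))"
    proof -
      have "1 / y1 > 0" using pos by simp
      with A' show ?thesis unfolding A'_def
        by (intro cf_append_one_minus_one y0[unfolded A'_def]) linarith+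
    qed
    finally show ?thesis by (simp only: y4_def w4_def)
  qed
  from has_value_shifted[where f = f, OF f_nonempty entries p w_pos w_less this]
  show "cf_has_value (0 ## (p - 1) ## overlined f) (1 / of_int p + 1 / of_int p *
      (2 * of_int p * of_int v / (1 + \<alpha> * hyp01_quot (1 / 2) (1 / \<alpha> ^ 2))))"
    by (simp add: w_def k_def c_def \<nu>_def t_def)
qed

section \<open>Passage to the closed forms\<close>

text \<open>The prefactor \<open>sqrt (v / u)\<close> cancels the root in the argument of the
  Bessel, tangent and hyperbolic tangent functions.\<close>

lemma sqrt_quot_mult:
  fixes q r s :: real
  assumes "r > 0" "s > 0"
  shows "sqrt (r / s) * (1 / (q * sqrt (s * r))) = 1 / (q * s)"
  using assms by (simp add: real_sqrt_divide real_sqrt_mult)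

theorem theorem10:
  fixes a b p u v :: int
  shows
    "(\<forall>x. x = 0 ## overlined (\<lambda>n.
          [p - 1, 1, u * (a + 2 * int n * b) - 1, p - 1, 1, v * (a + (2 * int n + 1) * b) - 1])
        \<longrightarrow> b > 0 \<longrightarrow> cf_positive x \<longrightarrow>
        cf_has_value x
          (1 / real_of_int p + 1 / real_of_int p * sqrt (real_of_int v / real_of_int u) *
             (bessel_I (real_of_int a / real_of_int b)
                (2 / (real_of_int b * real_of_int p * sqrt (real_of_int u * real_of_int v))) /
              bessel_I (real_of_int a / real_of_int b - 1)
                (2 / (real_of_int b * real_of_int p * sqrt (real_of_int u * real_of_int v))))))
     \<and> (\<forall>x. x = 0 ## (p - 1) ## overlined (\<lambda>n.
          [1, (4 * int n + 1) * u - 1, p, (4 * int n + 3) * v - 1, 1, p - 2])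
        \<longrightarrow> cf_positive x \<longrightarrow>
        cf_has_value x
          (1 / real_of_int p + 1 / real_of_int p * sqrt (real_of_int v / real_of_int u) *
             tan (1 / (real_of_int p * sqrt (real_of_int u * real_of_int v)))))
     \<and> (\<forall>x. x = 0 ## overlined (\<lambda>n.
          [p - 1, 1, (4 * int n + 1) * u - 1, p - 1, 1, (4 * int n + 3) * v - 1])
        \<longrightarrow> cf_positive x \<longrightarrow>
        cf_has_value x
          (1 / real_of_int p + 1 / real_of_int p * sqrt (real_of_int v / real_of_int u) *
             tanh (1 / (real_of_int p * sqrt (real_of_int u * real_of_int v)))))
     \<and> (\<forall>x. x = 0 ## (p - 1) ## overlined (\<lambda>n.
          [1, (4 * int n + 1) * u - 1, p - 1, 1, 2 * v - 1, p,
           (4 * int n + 3) * u - 1, 1, p - 1, 2 * v - 1, 1, p - 2])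
        \<longrightarrow> cf_positive x \<longrightarrow>
        cf_has_value x
          (1 / real_of_int p + real_of_int v *
             (1 - exp (- (1 / (real_of_int u * (real_of_int p)\<^sup>2 * real_of_int v))))))"
proof (intro conjI allI impI)
  fix x
  assume x: "x = 0 ## overlined (\<lambda>n.
      [p - 1, 1, u * (a + 2 * int n * b) - 1, p - 1, 1, v * (a + (2 * int n + 1) * b) - 1])"
    and b: "b > 0" and pos: "cf_positive x"
  note hyp01 = has_value_hyp01_quot[OF b pos[unfolded x]]
  define z where "z = 2 / (real_of_int b * of_int p * sqrt (of_int u * of_int v))"
  have z: "z > 0" using hyp01(1,3,4) b by (simp add: z_def)
  have z2: "z\<^sup>2 / 4 = 1 / (of_int b ^ 2 * of_int p ^ 2 * of_int u * of_int v)"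
    using hyp01(1,3,4) by (simp add: z_def power_divide power_mult_distrib)
  have "sqrt (of_int v / of_int u) * (z / 2) = 1 / (of_int p * of_int u * of_int b)"
    using sqrt_quot_mult[of "of_int v" "of_int u" "of_int b * of_int p"] hyp01(3,4)
    by (simp add: z_def mult_ac)
  then have "sqrt (of_int v / of_int u) *
      (bessel_I (of_int a / of_int b) z / bessel_I (of_int a / of_int b - 1) z)
      = 1 / (of_int p * of_int u * of_int b * hyp01_quot (of_int a / of_int b) (z\<^sup>2 / 4))"
    using hyp01(2) b z by (simp add: bessel_I_quot)
  then show "cf_has_value x (1 / real_of_int p + 1 / real_of_int p * sqrt (real_of_int v / real_of_int u) *
      (bessel_I (real_of_int a / real_of_int b)
        (2 / (real_of_int b * real_of_int p * sqrt (real_of_int u * real_of_int v))) /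
       bessel_I (real_of_int a / real_of_int b - 1)
        (2 / (real_of_int b * real_of_int p * sqrt (real_of_int u * real_of_int v)))))"
    using hyp01(5) unfolding z2 z_def[symmetric] x by (simp only: mult.assoc)
next
  fix x
  assume x: "x = 0 ## (p - 1) ## overlined (\<lambda>n.
      [1, (4 * int n + 1) * u - 1, p, (4 * int n + 3) * v - 1, 1, p - 2])"
    and pos: "cf_positive x"
  note tan = has_value_tan[OF pos[unfolded x]]
  define z where "z = 1 / (real_of_int p * sqrt (of_int u * of_int v))"
  have z2: "z\<^sup>2 / 4 = 1 / (4 * of_int p ^ 2 * of_int u * of_int v)"
    using tan(1-3) by (simp add: z_def power_divide power_mult_distrib)
  have "sqrt (of_int v / of_int u) * (z / 2) = 1 / (2 * of_int p * of_int u)"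
    using sqrt_quot_mult[of "of_int v" "of_int u" "2 * of_int p"] tan(2,3)
    by (simp add: z_def mult_ac)
  then have "sqrt (of_int v / of_int u) * tan z
      = 1 / (2 * of_int p * of_int u * hyp01_quot (1 / 2) (- (z\<^sup>2 / 4)))"
    by (simp add: tan_eq_hyp01_quot)
  then show "cf_has_value x (1 / real_of_int p + 1 / real_of_int p * sqrt (real_of_int v / real_of_int u) *
      tan (1 / (real_of_int p * sqrt (real_of_int u * real_of_int v))))"
    using tan(4) unfolding z2 z_def[symmetric] x by (simp only: mult.assoc)
next
  fix x
  assume x: "x = 0 ## overlined (\<lambda>n.
      [p - 1, 1, (4 * int n + 1) * u - 1, p - 1, 1, (4 * int n + 3) * v - 1])"
    and pos: "cf_positive x"
  have x': "x = 0 ## overlined (\<lambda>n.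
      [p - 1, 1, u * (1 + 2 * int n * 2) - 1, p - 1, 1, v * (1 + (2 * int n + 1) * 2) - 1])"
    unfolding x by (simp add: algebra_simps)
  have "(0 :: int) < 2" by simp
  note tanh = has_value_hyp01_quot[OF this pos[unfolded x']]
  define z where "z = 1 / (real_of_int p * sqrt (of_int u * of_int v))"
  have z2: "z\<^sup>2 / 4 = 1 / (of_int 2 ^ 2 * of_int p ^ 2 * of_int u * of_int v)"
    using tanh(1,3,4) by (simp add: z_def power_divide power_mult_distrib)
  have "sqrt (of_int v / of_int u) * (z / 2) = 1 / (of_int p * of_int u * of_int 2)"
    using sqrt_quot_mult[of "of_int v" "of_int u" "2 * of_int p"] tanh(3,4)
    by (simp add: z_def mult_ac)
  then have "sqrt (of_int v / of_int u) * tanh z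
      = 1 / (of_int p * of_int u * of_int 2 * hyp01_quot (of_int 1 / of_int 2) (z\<^sup>2 / 4))"
    by (simp add: tanh_eq_hyp01_quot)
  then show "cf_has_value x (1 / real_of_int p + 1 / real_of_int p * sqrt (real_of_int v / real_of_int u) *
      tanh (1 / (real_of_int p * sqrt (real_of_int u * real_of_int v))))"
    using tanh(5) unfolding z2 z_def[symmetric] x' by (simp only: mult.assoc)
next
  fix x
  assume x: "x = 0 ## (p - 1) ## overlined (\<lambda>n.
      [1, (4 * int n + 1) * u - 1, p - 1, 1, 2 * v - 1, p,
       (4 * int n + 3) * u - 1, 1, p - 1, 2 * v - 1, 1, p - 2])"
    and pos: "cf_positive x"
  note coth = has_value_coth[OF pos[unfolded x]]
  define \<alpha> where "\<alpha> = 4 * real_of_int u * of_int p ^ 2 * of_int v"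
  define z where "z = 2 / \<alpha>"
  define R where "R = hyp01_quot (1 / 2) (1 / \<alpha>\<^sup>2)"
  have \<alpha>: "\<alpha> > 0" using coth(1-3) by (simp add: \<alpha>_def)
  then have R: "R > 0" unfolding R_def by (intro hyp01_quot_pos) auto
  have "tanh z = 1 / (\<alpha> * R)"
    by (simp add: tanh_eq_hyp01_quot z_def R_def power_divide)
  moreover have "tanh z = (1 - exp (- (2 * z))) / (1 + exp (- (2 * z)))"
    by (simp add: tanh_real_altdef)
  \<comment> \<open>Used with \<open>K\<close> the hyperbolic cotangent of \<open>z\<close> and
    \<open>e = exp (- (2 * z))\<close>.\<close>
  moreover have "2 / (1 + K) = 1 - e" if "1 / K = (1 - e) / (1 + e)" "K > 0" "e > 0" for K e :: real
  proof -
    have "1 + K \<noteq> 0" "1 + e \<noteq> 0" using that by auto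
    then show ?thesis using that by (simp add: field_simps)
  qed
  ultimately have "2 / (1 + \<alpha> * R) = 1 - exp (- (2 * z))"
    using \<alpha> R by simp
  moreover have "2 * z = 1 / (of_int u * of_int p ^ 2 * of_int v)"
    by (simp add: z_def \<alpha>_def)
  moreover have "1 / of_int p * (2 * of_int p * of_int v / (1 + \<alpha> * R)) = of_int v * (2 / (1 + \<alpha> * R))"
    using coth(1) by simp
  ultimately have "1 / of_int p * (2 * of_int p * of_int v / (1 + \<alpha> * R))
      = of_int v * (1 - exp (- (1 / (of_int u * of_int p ^ 2 * of_int v))))"
    by (simp only:)
  then show "cf_has_value x (1 / real_of_int p + real_of_int v *
      (1 - exp (- (1 / (real_of_int u * (real_of_int p)\<^sup>2 * real_of_int v)))))"
    using coth(4) unfolding \<alpha>_def[symmetric] R_def[symmetric] x by simp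
qed

end
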